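(* Let $\Omega=\mathbb{C}\setminus\{0,1\}$ and $\xi=1$. Then, for $p\in\Omega$ with $\delta=|p|=\operatorname{dist}(p,0)>0$ sufficiently small, $$F_K^{\Omega}(p,\xi)\approx\frac{1}{\delta\log(1/\delta)},$$ that is, there exist constants $\delta_0\in(0,1)$ and $c,C>0$ such that for every $p\in\Omega$ with $0<\delta=|p|<\delta_0$, $$\frac{c}{\delta\log(1/\delta)}\le F_K^{\Omega}(p,1)\le\frac{C}{\delta\log(1/\delta)}.$$
   Context: Let $\Delta$ be the open unit disc in $\mathbb{C}$. For a domain $\Omega\subset\mathbb{C}^n$, $p\in\Omega$ and $\xi\in\mathbb{C}^n$, the Kobayashi (pseudo)metric is $$F_K^{\Omega}(p,\xi)=\inf\{|\alpha| : f:\Delta\to\Omega\text{ holomorphic},\ f(0)=p,\ \alpha>0,\ \alpha f'(0)=\xi\}.$$ *)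

theory Defs
  imports "HOL-Complex_Analysis.Complex_Analysis"
begin

text \<open>
  The Kobayashi (pseudo)metric of a domain in the complex plane, i.e. the case \<open>n = 1\<close> of domains
  in complex n-space. Here \<open>\<alpha>\<close> is a positive real. The infimum is the one of the
  conditionally complete order on the reals; it is meaningful because the set is bounded below
  by 0 and, for open \<open>\<Omega>\<close> and \<open>p \<in> \<Omega>\<close>, nonempty (lemma \<open>kobayashi_candidates_nonempty\<close>).
\<close>

definition kobayashi_candidates :: "complex set \<Rightarrow> complex \<Rightarrow> complex \<Rightarrow> real set" where
  "kobayashi_candidates \<Omega> p \<xi> =
     {\<bar>\<alpha>\<bar> | (\<alpha> :: real) f. f holomorphic_on ball 0 1 \<and> f ` ball 0 1 \<subseteq> \<Omega> \<and> f 0 = p \<and>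
        \<alpha> > 0 \<and> of_real \<alpha> * deriv f 0 = \<xi>}"

definition kobayashi_metric :: "complex set \<Rightarrow> complex \<Rightarrow> complex \<Rightarrow> real" where
  "kobayashi_metric \<Omega> p \<xi> = Inf (kobayashi_candidates \<Omega> p \<xi>)"

lemma kobayashi_candidates_bdd_below: "bdd_below (kobayashi_candidates \<Omega> p \<xi>)"
  by (rule bdd_belowI[of _ 0]) (auto simp: kobayashi_candidates_def)

lemma kobayashi_candidates_nonempty:
  assumes "open \<Omega>" "p \<in> \<Omega>"
  shows "kobayashi_candidates \<Omega> p \<xi> \<noteq> {}"
proof -
  obtain r where r: "r > 0" "ball p r \<subseteq> \<Omega>"
    using assms by (meson open_contains_ball)
  define \<alpha> where "\<alpha> = (norm \<xi> + 1) / r"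
  define f where "f = (\<lambda>z. p + \<xi> / of_real \<alpha> * z)"
  have \<alpha>: "\<alpha> > 0"
    using r by (simp add: \<alpha>_def add_nonneg_pos)
  have small: "norm (\<xi> / of_real \<alpha>) < r"
    using r \<alpha> by (simp add: norm_divide pos_divide_less_eq) (simp add: \<alpha>_def)
  have "f ` ball 0 1 \<subseteq> ball p r"
  proof
    fix w assume "w \<in> f ` ball 0 1"
    then obtain z where z: "norm z < 1" "w = f z" by auto
    have "dist p w = norm (\<xi> / of_real \<alpha>) * norm z"
      by (simp add: z f_def dist_norm norm_mult norm_divide)
    also have "\<dots> \<le> norm (\<xi> / of_real \<alpha>)"
      using z by (intro mult_left_le) auto
    finally show "w \<in> ball p r"
      using small by simp
  qed
  moreover have "f holomorphic_on ball 0 1"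
    unfolding f_def by (intro holomorphic_intros) (use \<alpha> in auto)
  moreover have "(f has_field_derivative \<xi> / of_real \<alpha>) (at 0)"
    unfolding f_def by (rule derivative_eq_intros refl | simp)+
  then have "of_real \<alpha> * deriv f 0 = \<xi>"
    using \<alpha> by (simp add: DERIV_imp_deriv)
  moreover have "f 0 = p" by (simp add: f_def)
  ultimately have "\<bar>\<alpha>\<bar> \<in> kobayashi_candidates \<Omega> p \<xi>"
    using \<alpha> r unfolding kobayashi_candidates_def by blast
  then show ?thesis by blast
qed

end

theory Submission
  imports Defs
begin

text \<open>
  Upper bound: the universal covering of the punctured unit disc, composed with a rotation, is a
  candidate with derivative of modulus \<open>2 \<delta> log (1/\<delta>)\<close>.

  Lower bound: if \<open>f\<close> omits 0 and 1, then \<open>h = log f / (2 \<pi> i)\<close> omits all integers. Writing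
  \<open>h = cos (\<pi> g)\<close>, the function \<open>g\<close> omits a set that meets every disc of radius 1, so Bloch's
  theorem gives \<open>\<bar>g' 0\<bar> < 12\<close>. Because \<open>sin\<^sup>2 + cos\<^sup>2 = 1\<close>, this bounds \<open>\<bar>h' 0\<bar>\<close>
  linearly in \<open>\<bar>h 0\<bar>\<close>, which is of order \<open>log (1/\<delta>)\<close>, and \<open>f' = 2 \<pi> i h' f\<close>. Omitting all
  integers rather than just two values is what avoids the extra factor \<open>log \<bar>h 0\<bar>\<close> of
  Landau's theorem.
\<close>

text \<open>At a point with integer real part and imaginary part
  \<open>ln (n + sqrt (n^2 - 1)) / pi\<close> up to sign, \<open>cos (pi * w)\<close> equals the
  positive integer \<open>n\<close> up to sign, so the outer cosine is 1 or -1. These points form a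
  grid, symmetric about the real axis, from which \<open>b\<close> is at most 1/2 away horizontally
  and less than 1/2 vertically.\<close>

lemma unit_ball_meets_cos_cos_preimage:
  fixes b :: complex
  obtains w :: complex where "w \<in> ball b 1" "cos (pi * cos (pi * w)) = 1 \<or> cos (pi * cos (pi * w)) = -1"
proof -
  define s :: real where "s = (if Im b \<ge> 0 then 1 else -1)"
  obtain n :: nat where n: "0 < n" "\<bar>\<bar>Im b\<bar> - ln (n + sqrt ((real n)\<^sup>2 - 1)) / pi\<bar> < 1/2"
    using Schottky_lemma2[of "\<bar>Im b\<bar>"] by auto
  define l where "l = ln (n + sqrt ((real n)\<^sup>2 - 1)) / pi"
  define w where "w = Complex (of_int (round (Re b))) (s * l)"
  have "\<bar>Re (b - w)\<bar> \<le> 1/2"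
    using of_int_round_abs_le[of "Re b"] by (simp add: w_def abs_minus_commute)
  moreover have "\<bar>Im (b - w)\<bar> < 1/2"
    using n(2)[folded l_def] by (auto simp: w_def s_def abs_if split: if_splits)
  ultimately have "cmod (b - w) < 1"
    using cmod_le[of "b - w"] by linarith
  then have "w \<in> ball b 1"
    by (simp add: dist_norm)
  moreover have "cos (pi * cos (pi * w)) = 1 \<or> cos (pi * cos (pi * w)) = -1"
  proof (rule Schottky_lemma3)
    show "w \<in> (\<Union>m\<in>\<int>. \<Union>n\<in>{0<..}. {Complex m (ln (real n + sqrt ((real n)\<^sup>2 - 1)) / pi)}) \<union>
              (\<Union>m\<in>\<int>. \<Union>n\<in>{0<..}. {Complex m (- ln (real n + sqrt ((real n)\<^sup>2 - 1)) / pi)})"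
      using n(1) Ints_of_int[of "round (Re b)", where 'a = real]
      unfolding w_def s_def l_def by (cases "Im b \<ge> 0") (auto simp del: Complex_eq)
  qed
  ultimately show thesis
    by (rule that)
qed

lemma deriv_bound_omitting_Ints:
  assumes holh: "h holomorphic_on ball 0 1" and h: "\<And>z. z \<in> ball 0 1 \<Longrightarrow> h z \<notin> \<int>"
  shows "cmod (deriv h 0) \<le> 12 * pi * (1 + cmod (h 0))"
proof -
  \<comment> \<open>1 and -1 are the critical values of \<open>cos\<close>; since \<open>h\<close>
    omits them, it lifts holomorphically through \<open>cos\<close> on the disc.\<close>
  have "h z \<noteq> 1 \<and> h z \<noteq> -1" if "z \<in> ball 0 1" for z
    using h[OF that] by (metis Ints_1 Ints_minus)
  then obtain k where holk: "k holomorphic_on ball 0 1"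
    and k: "\<And>z. z \<in> ball 0 1 \<Longrightarrow> h z = cos (k z)"
    using contractible_imp_holomorphic_arccos[OF holh convex_imp_contractible[OF convex_ball]] by metis
  define g where "g = (\<lambda>z. k z / pi)"
  have holg: "g holomorphic_on ball 0 1"
    unfolding g_def by (intro holomorphic_intros holk) auto
  have hg: "h z = cos (pi * g z)" if "z \<in> ball 0 1" for z
    using k[OF that] by (simp add: g_def)
  have g': "cmod (deriv g 0) < 12"
  proof (rule ccontr)
    assume "\<not> ?thesis"
    \<comment> \<open>The 12 is the constant of \<open>Bloch\<close>: a derivative of modulus at
      least 12 puts a disc of radius 1 into the image of \<open>g\<close>. That disc contains a grid
      point, over which \<open>h\<close> takes an integer value.\<close>
    then obtain b where b: "ball b 1 \<subseteq> g ` ball 0 1"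
      using Bloch[OF holg, of 1] by auto
    obtain w :: complex where "w \<in> ball b 1" and w: "cos (pi * cos (pi * w)) = 1 \<or> cos (pi * cos (pi * w)) = -1"
      by (rule unit_ball_meets_cos_cos_preimage)
    then obtain z where z: "z \<in> ball 0 1" "w = g z"
      using b by blast
    then have "cos (pi * h z) ^ 2 = 1"
      using w hg by auto
    then have "sin (pi * h z) = 0"
      by (simp add: cos_squared_eq)
    then obtain n where "pi * h z = of_real (of_int n * pi)"
      by (auto simp: Complex_Transcendental.sin_eq_0)
    then have "h z = of_int n"
      by simp
    then show False
      using h[OF z(1)] by simp
  qed
  have "(g has_field_derivative deriv g 0) (at 0)"
    using holg by (intro holomorphic_derivI[of g "ball 0 1"]) auto
  then have "((\<lambda>z. cos (pi * g z)) has_field_derivative - sin (pi * g 0) * (pi * deriv g 0)) (at 0)"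
    by (auto intro!: derivative_eq_intros)
  then have "(h has_field_derivative - sin (pi * g 0) * (pi * deriv g 0)) (at 0)"
    by (rule has_field_derivative_transform_within_open[of _ _ _ "ball 0 1"]) (auto simp: hg)
  then have dh: "cmod (deriv h 0) = cmod (sin (pi * g 0)) * (pi * cmod (deriv g 0))"
    by (simp add: DERIV_imp_deriv norm_mult)
  have "cmod (sin (pi * g 0)) ^ 2 = cmod (1 - h 0 ^ 2)"
    by (simp add: hg sin_squared_eq flip: norm_power)
  also have "\<dots> \<le> 1 + cmod (h 0) ^ 2"
    by (metis norm_one norm_power norm_triangle_ineq4)
  also have "\<dots> \<le> (1 + cmod (h 0)) ^ 2"
    by (simp add: power2_eq_square algebra_simps)
  finally have "cmod (sin (pi * g 0)) \<le> 1 + cmod (h 0)"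
    by (rule power2_le_imp_le) simp
  then have "cmod (deriv h 0) \<le> (1 + cmod (h 0)) * (pi * 12)"
    unfolding dh using g' by (intro mult_mono) auto
  then show ?thesis
    by (simp add: algebra_simps)
qed

lemma deriv_bound_omitting_0_1:
  assumes holf: "f holomorphic_on ball 0 1" and f: "f ` ball 0 1 \<subseteq> UNIV - {0, 1}"
  shows "cmod (deriv f 0) \<le> 12 * pi * cmod (f 0) * (3 * pi + \<bar>ln (cmod (f 0))\<bar>)"
proof -
  have f0: "f z \<noteq> 0" "f z \<noteq> 1" if "z \<in> ball 0 1" for z
    using f that by (blast, blast)
  then obtain g where holg: "g holomorphic_on ball 0 1"
    and g: "\<And>z. z \<in> ball 0 1 \<Longrightarrow> f z = exp (g z)"
    using contractible_imp_holomorphic_log[OF holf convex_imp_contractible[OF convex_ball]] by metis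
  \<comment> \<open>The branch \<open>g\<close> may differ from \<open>Ln (f 0)\<close> at 0 by any
    multiple of \<open>2 * pi * \<i>\<close>. Shifting it to the principal value makes the imaginary
    part at 0 at most \<open>pi\<close> in modulus, so \<open>h 0\<close> is controlled by
    \<open>ln (cmod (f 0))\<close> alone. With the summand \<open>2 * pi\<close> below, this
    \<open>pi\<close> makes up the \<open>3 * pi\<close>.\<close>
  define h where "h = (\<lambda>z. (g z - g 0 + Ln (f 0)) / (2 * pi * \<i>))"
  have holh: "h holomorphic_on ball 0 1"
    unfolding h_def by (intro holomorphic_intros holg) auto
  have fh: "f z = exp (2 * pi * \<i> * h z)" if "z \<in> ball 0 1" for z
  proof -
    have "exp (g z - g 0 + Ln (f 0)) = exp (g z)"
      using f0[of 0] g[of 0] by (simp add: exp_add exp_diff)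
    then show ?thesis
      using g[OF that] by (simp add: h_def)
  qed
  have "h z \<notin> \<int>" if "z \<in> ball 0 1" for z
  proof
    assume "h z \<in> \<int>"
    then obtain n where "h z = of_int n"
      by (auto elim: Ints_cases)
    then have "f z = 1"
      using fh[OF that] exp_integer_2pi[of "of_int n"] by (simp add: mult_ac)
    then show False
      using f0[OF that] by simp
  qed
  then have dh: "cmod (deriv h 0) \<le> 12 * pi * (1 + cmod (h 0))"
    by (intro deriv_bound_omitting_Ints holh)
  have "cmod (Ln (f 0)) \<le> \<bar>Re (Ln (f 0))\<bar> + \<bar>Im (Ln (f 0))\<bar>"
    by (rule cmod_le)
  also have "\<dots> \<le> \<bar>ln (cmod (f 0))\<bar> + pi"
    using f0[of 0] mpi_less_Im_Ln[of "f 0"] Im_Ln_le_pi[of "f 0"] by auto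
  finally have h0: "2 * pi * cmod (h 0) \<le> \<bar>ln (cmod (f 0))\<bar> + pi"
    by (simp add: h_def norm_divide norm_mult)
  have "(h has_field_derivative deriv h 0) (at 0)"
    using holh by (intro holomorphic_derivI[of h "ball 0 1"]) auto
  then have "((\<lambda>z. exp (2 * pi * \<i> * h z)) has_field_derivative
      exp (2 * pi * \<i> * h 0) * (2 * pi * \<i> * deriv h 0)) (at 0)"
    by (auto intro!: derivative_eq_intros)
  then have "(f has_field_derivative exp (2 * pi * \<i> * h 0) * (2 * pi * \<i> * deriv h 0)) (at 0)"
    by (rule has_field_derivative_transform_within_open[of _ _ _ "ball 0 1"]) (auto simp: fh)
  then have "cmod (deriv f 0) = cmod (f 0) * (2 * pi * cmod (deriv h 0))"
    by (simp add: DERIV_imp_deriv norm_mult fh)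
  also have "\<dots> \<le> cmod (f 0) * (2 * pi * (12 * pi * (1 + cmod (h 0))))"
    using dh by (intro mult_left_mono) auto
  also have "\<dots> = 12 * pi * cmod (f 0) * (2 * pi + 2 * pi * cmod (h 0))"
    by (simp add: algebra_simps)
  also have "\<dots> \<le> 12 * pi * cmod (f 0) * (3 * pi + \<bar>ln (cmod (f 0))\<bar>)"
    using h0 by (intro mult_left_mono) auto
  finally show ?thesis .
qed

lemma kobayashi_metric_lower:
  assumes p: "p \<noteq> 0" "cmod p < exp (-1)"
  shows "1 / (12 * pi * (3 * pi + 1)) / (cmod p * ln (1 / cmod p))
           \<le> kobayashi_metric (UNIV - {0, 1}) p 1"
  unfolding kobayashi_metric_def
proof (rule cInf_greatest)
  have "p \<noteq> 1"
    using p by auto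
  moreover have "open (UNIV - {0, 1::complex})"
    by (simp add: open_Diff)
  ultimately show "kobayashi_candidates (UNIV - {0, 1}) p 1 \<noteq> {}"
    using p by (intro kobayashi_candidates_nonempty) auto
next
  fix x
  assume "x \<in> kobayashi_candidates (UNIV - {0, 1}) p 1"
  then obtain f where holf: "f holomorphic_on ball 0 1" and f: "f ` ball 0 1 \<subseteq> UNIV - {0, 1}"
    and f0: "f 0 = p" and x: "x > 0" "of_real x * deriv f 0 = 1"
    by (auto simp: kobayashi_candidates_def)
  define L where "L = ln (1 / cmod p)"
  have "ln (cmod p) < -1"
    using p by (metis ln_exp ln_less_cancel_iff exp_gt_zero zero_less_norm_iff)
  then have L: "L > 1" "\<bar>ln (cmod p)\<bar> = L"
    using p by (auto simp: L_def ln_div)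
  have "1 = x * cmod (deriv f 0)"
    using arg_cong[OF x(2), of cmod] x(1) by (simp add: norm_mult)
  also have "\<dots> \<le> x * (12 * pi * cmod p * (3 * pi + L))"
    using deriv_bound_omitting_0_1[OF holf f] x(1) by (simp add: f0 L)
  \<comment> \<open>The cutoff \<open>exp (-1)\<close> enters here: \<open>L > 1\<close> absorbs the
    additive constant \<open>3 * pi\<close> into a multiple of \<open>L\<close>.\<close>
  also have "\<dots> \<le> x * (12 * pi * cmod p * ((3 * pi + 1) * L))"
    using x(1) L(1) by (intro mult_left_mono) (auto simp: algebra_simps)
  finally have "1 \<le> x * (12 * pi * (3 * pi + 1) * (cmod p * L))"
    by (simp only: mult_ac)
  moreover have "12 * pi * (3 * pi + 1) * (cmod p * L) > 0"
    using L(1) p(1) by (intro mult_pos_pos add_pos_pos) auto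
  ultimately have "1 / (12 * pi * (3 * pi + 1) * (cmod p * L)) \<le> x"
    by (simp add: pos_divide_le_eq)
  then show "1 / (12 * pi * (3 * pi + 1)) / (cmod p * ln (1 / cmod p)) \<le> x"
    by (simp add: L_def)
qed

text \<open>A single candidate bounds the infimum from above. The factor 1/2 comes from
  \<open>2 * L * w / (1 - w)\<close>, whose derivative at 0 is \<open>2 * L\<close>.\<close>

lemma kobayashi_metric_upper:
  assumes p: "p \<noteq> 0" "cmod p < 1"
  shows "kobayashi_metric (UNIV - {0, 1}) p 1 \<le> (1/2) / (cmod p * ln (1 / cmod p))"
proof -
  define L where "L = ln (1 / cmod p)"
  have L: "L > 0" "exp L = 1 / cmod p"
    using p by (auto simp: L_def)
  \<comment> \<open>A candidate needs a positive real multiple of \<open>deriv f 0\<close> to be 1;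
    this rotation makes \<open>deriv f 0\<close> equal to \<open>2 * L * cmod p\<close>.\<close>
  define u where "u = - cnj p / cmod p"
  have u: "cmod u = 1" "u * p = - cmod p"
    using p by (auto simp: u_def norm_divide mult.commute[of "cnj p"] power2_eq_square
        simp flip: complex_norm_square)
  \<comment> \<open>\<open>L + 2 L w / (1 - w) = L (1 + w) / (1 - w)\<close> maps the unit disc to the right half-plane\<close>
  define f where "f = (\<lambda>z. p * exp (- (2 * L * (u * z) / (1 - u * z))))"
  have uz: "cmod (u * z) < 1" if "z \<in> ball 0 1" for z
    using that u by (simp add: norm_mult)
  then have nz: "1 - u * z \<noteq> 0" if "z \<in> ball 0 1" for z
    using that by fastforce
  have "f holomorphic_on ball 0 1"
    unfolding f_def by (intro holomorphic_intros nz) auto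
  moreover have "f z \<noteq> 0 \<and> f z \<noteq> 1" if "z \<in> ball 0 1" for z
  proof -
    define w where "w = u * z"
    have w: "cmod w < 1" "1 - w \<noteq> 0"
      using uz[OF that] nz[OF that] by (auto simp: w_def)
    define d where "d = (cmod (1 - w))\<^sup>2"
    have d: "d > 0" "d = (1 - Re w)\<^sup>2 + (Im w)\<^sup>2"
      using w(2) by (simp add: d_def, simp add: d_def cmod_power2)
    have Re_w: "Re (w / (1 - w)) = (Re w * (1 - Re w) - (Im w)\<^sup>2) / d"
      unfolding d(2) by (simp add: Re_divide power2_eq_square)
    \<comment> \<open>This quotient is the Poisson kernel, the real part of
      \<open>(1 + w) / (1 - w) = 1 + 2 * w / (1 - w)\<close>.\<close>
    have "0 < (1 - (cmod w)\<^sup>2) / d"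
      using w d(1) by (intro divide_pos_pos) (auto simp: abs_square_less_1)
    also have "1 - (cmod w)\<^sup>2 = d + 2 * (Re w * (1 - Re w) - (Im w)\<^sup>2)"
      unfolding d(2) cmod_power2 by (simp add: power2_eq_square algebra_simps)
    also have "\<dots> / d = 1 + 2 * Re (w / (1 - w))"
      unfolding Re_w using d(1) by (simp add: add_divide_distrib)
    finally have "L * (- (2 * Re (w / (1 - w)))) < L * 1"
      using L by (intro mult_strict_left_mono) auto
    moreover have "of_real (2 * L) * w / (1 - w) = of_real (2 * L) * (w / (1 - w))"
      by simp
    then have "Re (of_real (2 * L) * w / (1 - w)) = 2 * L * Re (w / (1 - w))"
      by (simp only: scaleR_conv_of_real[symmetric] scaleR_complex.sel)
    ultimately have "Re (- (of_real (2 * L) * w / (1 - w))) < L"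
      by simp
    then have "cmod (exp (- (of_real (2 * L) * w / (1 - w)))) < 1 / cmod p"
      unfolding norm_exp_eq_Re L(2)[symmetric] by simp
    \<comment> \<open>The modulus bound excludes the value 1; the value 0 is excluded because
      \<open>p\<close> and the exponential are nonzero.\<close>
    then have "cmod (f z) < 1"
      using p by (simp add: f_def w_def norm_mult pos_less_divide_eq mult.commute[of "cmod p"] del: norm_exp_eq_Re)
    then show ?thesis
      using p by (auto simp: f_def)
  qed
  then have "f ` ball 0 1 \<subseteq> UNIV - {0, 1}"
    by auto
  moreover have "f 0 = p"
    by (simp add: f_def)
  moreover have "(f has_field_derivative p * - (2 * L * u)) (at 0)"
    unfolding f_def by (rule derivative_eq_intros refl | simp)+
  then have "deriv f 0 = - (2 * L) * (u * p)"
    by (simp add: DERIV_imp_deriv mult_ac)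
  then have "of_real (1 / (2 * (cmod p * L))) * deriv f 0 = 1"
    using p L u(2) by simp
  moreover have "1 / (2 * (cmod p * L)) > 0"
    using p L by simp
  ultimately have "\<bar>1 / (2 * (cmod p * L))\<bar> \<in> kobayashi_candidates (UNIV - {0, 1}) p 1"
    unfolding kobayashi_candidates_def by blast
  then have "kobayashi_metric (UNIV - {0, 1}) p 1 \<le> \<bar>1 / (2 * (cmod p * L))\<bar>"
    unfolding kobayashi_metric_def by (intro cInf_lower kobayashi_candidates_bdd_below)
  then show ?thesis
    using L p by (simp add: L_def[symmetric] abs_mult)
qed

theorem theorem1:
  "\<exists>\<delta>\<^sub>0 c C :: real. 0 < \<delta>\<^sub>0 \<and> \<delta>\<^sub>0 < 1 \<and> 0 < c \<and> 0 < C \<and>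
     (\<forall>p \<in> UNIV - {0, 1 :: complex}. 0 < cmod p \<and> cmod p < \<delta>\<^sub>0 \<longrightarrow>
        c / (cmod p * ln (1 / cmod p)) \<le> kobayashi_metric (UNIV - {0, 1}) p 1 \<and>
        kobayashi_metric (UNIV - {0, 1}) p 1 \<le> C / (cmod p * ln (1 / cmod p)))"
proof -
  have "exp (-1) < (1::real)"
    by simp
  moreover have "0 < 1 / (12 * pi * (3 * pi + 1))"
    by (intro divide_pos_pos mult_pos_pos add_pos_pos) auto
  moreover have "cmod p < 1" if "cmod p < exp (-1)" for p
    using that \<open>exp (-1) < (1::real)\<close> by linarith
  ultimately show ?thesis
    by (intro exI[of _ "exp (-1)"] exI[of _ "1 / (12 * pi * (3 * pi + 1))"] exI[of _ "1/2"] conjI ballI impI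
        kobayashi_metric_lower kobayashi_metric_upper) auto
qed

end
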